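(* Let $\mathcal{A}_m\subset\Omega_{n_m}$ ($m=1,2,\dots$) be a sequence of events, and set $g_m=\chi_{\mathcal{A}_m}$. Then $\{\mathcal{A}_m\}$ is asymptotically noise sensitive if and only if for every finite $k$ $$\lim_{m}\sum\bigl\{\hat g_m(S)^2: S\subset\{1,\dots,n_m\},\ 1\le|S|\le k\bigr\}=0 .$$ $\{\mathcal{A}_m\}$ is uniformly stable if and only if $$\lim_{k\to\infty}\sup_m\sum\bigl\{\hat g_m(S)^2: S\subset\{1,\dots,n_m\},\ |S|\ge k\bigr\}=0 .$$
   Context: $\Omega_n=\{0,1\}^n$ carries the uniform probability measure $\mathbf{P}$; an event is a subset $\mathcal{A}\subset\Omega_n$, and $\chi_{\mathcal{A}}$ is its indicator function. Fourier-Walsh expansion: elements $x\in\Omega_n$ are identified with subsets $\{j:x_j=1\}$ of $\{1,\dots,n\}$. For $S\subset\{1,\dots,n\}$, $u_S(T)=(-1)^{|S\cap T|}$, and $f:\Omega_n\to\mathbb{R}$ is expanded as $f=\sum_{S}\hat f(S)u_S$. Noise: for $x\in\Omega_n$ and $\epsilon\in(0,1)$, $N_\epsilon(x)$ is the random element of $\Omega_n$ whose coordinates are, independently, $x_j$ with probability $1-\epsilon$ and $1-x_j$ with probability $\epsilon$. Sensitivity: for an event $\mathcal{A}\subset\Omega_n$ and $\delta>0$, let $$\gamma(\mathcal{A},\epsilon,\delta)=\mathbf{P}\Bigl\{x\in\Omega_n:\bigl|\mathbf{P}(N_\epsilon(x)\in\mathcal{A}\mid x)-\mathbf{P}(\mathcal{A})\bigr|>\delta\Bigr\},\qquad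 \phi(\mathcal{A},\epsilon)=\inf\{\delta>0:\gamma(\mathcal{A},\epsilon,\delta)<\delta\}.$$ A sequence of events $\mathcal{A}_m\subset\Omega_{n_m}$ is asymptotically noise sensitive if $\lim_{m\to\infty}\phi(\mathcal{A}_m,\epsilon)=0$ for every $\epsilon\in(0,1/2)$. Stability: with $x$ uniform in $\Omega_n$, $\mathbf{P}[\mathcal{A}\triangle N_\epsilon\mathcal{A}]$ denotes the probability that exactly one of $x\in\mathcal{A}$, $N_\epsilon(x)\in\mathcal{A}$ holds. A collection $\{\mathcal{A}_i\}$ is uniformly stable if $\lim_{\epsilon\to0}\mathbf{P}[\mathcal{A}_i\triangle N_\epsilon\mathcal{A}_i]=0$ uniformly in $i$. *)

theory Defs
  imports "HOL-Probability.Probability"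
begin

definition Omega :: "nat \<Rightarrow> (nat \<Rightarrow> bool) set" where
  "Omega n = {1..n} \<rightarrow>\<^sub>E UNIV"

text \<open>
  The bit \<open>1\<close> is \<open>True\<close>. Restricting to \<open>{1..n}\<close> matters: elements of \<open>Omega n\<close> take the
  arbitrary boolean value \<open>undefined\<close> outside this set.
\<close>

definition ones :: "nat \<Rightarrow> (nat \<Rightarrow> bool) \<Rightarrow> nat set" where
  "ones n x = {j \<in> {1..n}. x j}"

definition walsh :: "nat \<Rightarrow> nat set \<Rightarrow> (nat \<Rightarrow> bool) \<Rightarrow> real" where
  "walsh n S x = (-1) ^ card (S \<inter> ones n x)"

text \<open>
  The coefficients of the Fourier-Walsh expansion. They are well defined by
  \<open>walsh_expansion_ex1\<close> below, and \<open>fourier_eq\<close> gives the usual inner product formula.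
\<close>

definition fourier :: "nat \<Rightarrow> ((nat \<Rightarrow> bool) \<Rightarrow> real) \<Rightarrow> nat set \<Rightarrow> real" where
  "fourier n f = (THE c. (\<forall>S. \<not> S \<subseteq> {1..n} \<longrightarrow> c S = 0) \<and>
     (\<forall>x\<in>Omega n. f x = (\<Sum>S | S \<subseteq> {1..n}. c S * walsh n S x)))"

definition unif :: "nat \<Rightarrow> (nat \<Rightarrow> bool) pmf" where
  "unif n = pmf_of_set (Omega n)"

text \<open>
  \<open>noise n \<epsilon> x\<close> is the law of \<open>N\<^sub>\<epsilon>(x)\<close>: the coordinates in \<open>{1..n}\<close> are flipped independently with
  probability \<open>\<epsilon>\<close>. The default value \<open>undefined\<close> makes it a law on \<open>Omega n\<close>.
\<close>

definition noise :: "nat \<Rightarrow> real \<Rightarrow> (nat \<Rightarrow> bool) \<Rightarrow> (nat \<Rightarrow> bool) pmf" where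
  "noise n \<epsilon> x = Pi_pmf {1..n} undefined
     (\<lambda>j. map_pmf (\<lambda>b. if b then \<not> x j else x j) (bernoulli_pmf \<epsilon>))"

definition sens_gamma :: "nat \<Rightarrow> (nat \<Rightarrow> bool) set \<Rightarrow> real \<Rightarrow> real \<Rightarrow> real" where
  "sens_gamma n A \<epsilon> \<delta> = measure_pmf.prob (unif n)
     {x \<in> Omega n. \<bar>measure_pmf.prob (noise n \<epsilon> x) A - measure_pmf.prob (unif n) A\<bar> > \<delta>}"

definition sens_phi :: "nat \<Rightarrow> (nat \<Rightarrow> bool) set \<Rightarrow> real \<Rightarrow> real" where
  "sens_phi n A \<epsilon> = Inf {\<delta>. \<delta> > 0 \<and> sens_gamma n A \<epsilon> \<delta> < \<delta>}"

definition asymp_noise_sensitive ::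
  "(nat \<Rightarrow> nat) \<Rightarrow> (nat \<Rightarrow> (nat \<Rightarrow> bool) set) \<Rightarrow> bool" where
  "asymp_noise_sensitive n A \<longleftrightarrow>
     (\<forall>\<epsilon>. 0 < \<epsilon> \<and> \<epsilon> < 1/2 \<longrightarrow> (\<lambda>m. sens_phi (n m) (A m) \<epsilon>) \<longlonglongrightarrow> 0)"

text \<open>The joint law of \<open>(x, N\<^sub>\<epsilon>(x))\<close> with \<open>x\<close> uniform.\<close>

definition noisy_pair :: "nat \<Rightarrow> real \<Rightarrow> ((nat \<Rightarrow> bool) \<times> (nat \<Rightarrow> bool)) pmf" where
  "noisy_pair n \<epsilon> = bind_pmf (unif n) (\<lambda>x. map_pmf (\<lambda>y. (x, y)) (noise n \<epsilon> x))"

definition flip_prob :: "nat \<Rightarrow> (nat \<Rightarrow> bool) set \<Rightarrow> real \<Rightarrow> real" where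
  "flip_prob n A \<epsilon> = measure_pmf.prob (noisy_pair n \<epsilon>) {(x, y). (x \<in> A) \<noteq> (y \<in> A)}"

definition uniformly_stable ::
  "'i set \<Rightarrow> ('i \<Rightarrow> nat) \<Rightarrow> ('i \<Rightarrow> (nat \<Rightarrow> bool) set) \<Rightarrow> bool" where
  "uniformly_stable I n A \<longleftrightarrow>
     uniform_limit I (\<lambda>\<epsilon> i. flip_prob (n i) (A i) \<epsilon>) (\<lambda>_. 0) (at_right 0)"

lemma finite_Omega [simp]: "finite (Omega n)"
  by (simp add: Omega_def finite_PiE)

lemma Omega_nonempty [simp]: "Omega n \<noteq> {}"
  by (simp add: Omega_def PiE_eq_empty_iff)

lemma card_Omega: "card (Omega n) = 2 ^ n"
  by (simp add: Omega_def card_PiE)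

lemma noise_in_Omega: "set_pmf (noise n \<epsilon> x) \<subseteq> Omega n"
proof
  fix y assume "y \<in> set_pmf (noise n \<epsilon> x)"
  then have "y j = undefined" if "j \<notin> {1..n}" for j
    using set_Pi_pmf_subset[of "{1..n}" undefined] that unfolding noise_def by blast
  then show "y \<in> Omega n" unfolding Omega_def by (intro PiE_I) blast+
qed

lemma walsh_eq_prod:
  assumes "S \<subseteq> {1..n}"
  shows "walsh n S x = (\<Prod>j\<in>S. if x j then -1 else 1)"
proof -
  have fin: "finite S" using assms finite_subset by blast
  have "(\<Prod>j\<in>S. if x j then -1 else (1::real)) = (\<Prod>j\<in>S \<inter> {j. x j}. -1)"
    using fin by (subst prod.inter_restrict) (auto intro!: prod.cong)
  moreover have "S \<inter> {j. x j} = S \<inter> ones n x" using assms by (auto simp: ones_def)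
  ultimately show ?thesis by (simp add: walsh_def)
qed

lemma walsh_eq_prod_full:
  assumes "S \<subseteq> {1..n}"
  shows "walsh n S x = (\<Prod>j\<in>{1..n}. if j \<in> S \<and> x j then -1 else 1)"
  unfolding walsh_eq_prod[OF assms]
  by (rule prod.mono_neutral_cong_left) (use assms in auto)

lemma walsh_orthogonal:
  assumes "S \<subseteq> {1..n}" "T \<subseteq> {1..n}"
  shows "(\<Sum>x\<in>Omega n. walsh n S x * walsh n T x) = (if S = T then 2 ^ n else 0)"
proof -
  define h :: "nat \<Rightarrow> bool \<Rightarrow> real" where
    "h j b = (if j \<in> S \<and> b then -1 else 1) * (if j \<in> T \<and> b then -1 else 1)" for j b
  have "(\<Sum>x\<in>Omega n. walsh n S x * walsh n T x) = (\<Sum>x\<in>Omega n. \<Prod>j\<in>{1..n}. h j (x j))"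
    unfolding walsh_eq_prod_full[OF assms(1)] walsh_eq_prod_full[OF assms(2)] h_def prod.distrib ..
  also have "\<dots> = (\<Prod>j\<in>{1..n}. \<Sum>b\<in>UNIV. h j b)"
    unfolding Omega_def by (rule prod_sum_PiE[symmetric]) auto
  also have "\<dots> = (\<Prod>j\<in>{1..n}. if (j \<in> S) = (j \<in> T) then 2 else 0)"
    by (rule prod.cong) (auto simp: h_def UNIV_bool)
  also have "\<dots> = (if S = T then 2 ^ n else 0)"
  proof (cases "S = T")
    case False
    then obtain j where "j \<in> {1..n}" "(j \<in> S) \<noteq> (j \<in> T)" using assms by blast
    with False show ?thesis by (auto intro!: prod_zero)
  qed simp
  finally show ?thesis .
qed

lemma walsh_dual_orthogonal:
  assumes "x \<in> Omega n" "y \<in> Omega n"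
  shows "(\<Sum>S | S \<subseteq> {1..n}. walsh n S x * walsh n S y) = (if x = y then 2 ^ n else 0)"
proof -
  define a :: "nat \<Rightarrow> real" where
    "a j = (if x j then -1 else 1) * (if y j then -1 else 1)" for j
  have "(\<Sum>S | S \<subseteq> {1..n}. walsh n S x * walsh n S y) = (\<Sum>S\<in>Pow {1..n}. \<Prod>j\<in>S. a j)"
    by (rule sum.cong) (auto simp: walsh_eq_prod a_def prod.distrib)
  also have "\<dots> = (\<Prod>j\<in>{1..n}. a j + 1)"
    by (subst prod_add) auto
  also have "\<dots> = (if x = y then 2 ^ n else 0)"
  proof (cases "x = y")
    case True
    then have "a = (\<lambda>_. 1)" by (auto simp: a_def)
    with True show ?thesis by simp
  next
    case False
    then have "\<exists>j\<in>{1..n}. x j \<noteq> y j"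
      using assms PiE_ext[of x "{1..n}" "\<lambda>_. UNIV" y] unfolding Omega_def by blast
    then have "\<exists>j\<in>{1..n}. a j + 1 = 0" by (force simp: a_def)
    then have "(\<Prod>j\<in>{1..n}. a j + 1) = 0" by (intro prod_zero) simp_all
    with False show ?thesis by simp
  qed
  finally show ?thesis .
qed

lemma walsh_expansion:
  assumes "x \<in> Omega n"
  shows "f x = (\<Sum>S | S \<subseteq> {1..n}. (\<Sum>y\<in>Omega n. f y * walsh n S y) / 2 ^ n * walsh n S x)"
proof -
  have "(\<Sum>S | S \<subseteq> {1..n}. (\<Sum>y\<in>Omega n. f y * walsh n S y) / 2 ^ n * walsh n S x) =
        (\<Sum>S | S \<subseteq> {1..n}. \<Sum>y\<in>Omega n. f y / 2 ^ n * (walsh n S y * walsh n S x))"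
    unfolding sum_divide_distrib sum_distrib_right by (intro sum.cong refl) simp
  also have "\<dots> = (\<Sum>y\<in>Omega n. f y / 2 ^ n * (\<Sum>S | S \<subseteq> {1..n}. walsh n S y * walsh n S x))"
    by (subst sum.swap) (simp add: sum_distrib_left)
  also have "\<dots> = (\<Sum>y\<in>Omega n. if y = x then f y else 0)"
    by (rule sum.cong) (simp_all add: walsh_dual_orthogonal assms del: One_nat_def)
  also have "\<dots> = f x" using assms by simp
  finally show ?thesis by simp
qed

lemma walsh_coeff_unique:
  assumes c: "\<And>x. x \<in> Omega n \<Longrightarrow> f x = (\<Sum>S | S \<subseteq> {1..n}. c S * walsh n S x)"
    and T: "T \<subseteq> {1..n}"
  shows "c T = (\<Sum>x\<in>Omega n. f x * walsh n T x) / 2 ^ n"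
proof -
  have "(\<Sum>x\<in>Omega n. f x * walsh n T x) =
        (\<Sum>x\<in>Omega n. \<Sum>S | S \<subseteq> {1..n}. c S * (walsh n S x * walsh n T x))"
    by (simp add: c sum_distrib_right mult.assoc)
  also have "\<dots> = (\<Sum>S | S \<subseteq> {1..n}. c S * (\<Sum>x\<in>Omega n. walsh n S x * walsh n T x))"
    by (subst sum.swap) (simp add: sum_distrib_left)
  also have "\<dots> = (\<Sum>S | S \<subseteq> {1..n}. if S = T then c S * 2 ^ n else 0)"
    by (rule sum.cong) (simp_all add: walsh_orthogonal T del: One_nat_def)
  also have "\<dots> = c T * 2 ^ n" using T by simp
  finally show ?thesis by simp
qed

lemma walsh_expansion_ex1:
  "\<exists>!c. (\<forall>S. \<not> S \<subseteq> {1..n} \<longrightarrow> c S = 0) \<and>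
     (\<forall>x\<in>Omega n. f x = (\<Sum>S | S \<subseteq> {1..n}. c S * walsh n S x))"
proof (rule ex_ex1I)
  define c where "c S = (if S \<subseteq> {1..n} then (\<Sum>y\<in>Omega n. f y * walsh n S y) / 2 ^ n else 0)" for S
  have "f x = (\<Sum>S | S \<subseteq> {1..n}. c S * walsh n S x)" if "x \<in> Omega n" for x
    unfolding walsh_expansion[OF that, of f] by (rule sum.cong) (simp_all add: c_def)
  moreover have "c S = 0" if "\<not> S \<subseteq> {1..n}" for S using that by (simp only: c_def if_False)
  ultimately show "\<exists>c. (\<forall>S. \<not> S \<subseteq> {1..n} \<longrightarrow> c S = 0) \<and>
     (\<forall>x\<in>Omega n. f x = (\<Sum>S | S \<subseteq> {1..n}. c S * walsh n S x))"
    by blast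
next
  fix c d :: "nat set \<Rightarrow> real"
  assume c: "(\<forall>S. \<not> S \<subseteq> {1..n} \<longrightarrow> c S = 0) \<and>
      (\<forall>x\<in>Omega n. f x = (\<Sum>S | S \<subseteq> {1..n}. c S * walsh n S x))"
    and d: "(\<forall>S. \<not> S \<subseteq> {1..n} \<longrightarrow> d S = 0) \<and>
      (\<forall>x\<in>Omega n. f x = (\<Sum>S | S \<subseteq> {1..n}. d S * walsh n S x))"
  show "c = d"
  proof
    fix S
    show "c S = d S"
    proof (cases "S \<subseteq> {1..n}")
      case True
      have "c S = (\<Sum>x\<in>Omega n. f x * walsh n S x) / 2 ^ n"
        by (rule walsh_coeff_unique[OF _ True]) (use c in blast)
      moreover have "d S = (\<Sum>x\<in>Omega n. f x * walsh n S x) / 2 ^ n"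
        by (rule walsh_coeff_unique[OF _ True]) (use d in blast)
      ultimately show ?thesis by (simp only:)
    next
      case False
      then have "c S = 0" "d S = 0" using c d by blast+
      then show ?thesis by (simp only:)
    qed
  qed
qed

lemma fourier_expansion:
  assumes "x \<in> Omega n"
  shows "f x = (\<Sum>S | S \<subseteq> {1..n}. fourier n f S * walsh n S x)"
proof -
  have "(\<forall>S. \<not> S \<subseteq> {1..n} \<longrightarrow> fourier n f S = 0) \<and>
     (\<forall>x\<in>Omega n. f x = (\<Sum>S | S \<subseteq> {1..n}. fourier n f S * walsh n S x))"
    unfolding fourier_def by (rule theI'[OF walsh_expansion_ex1])
  then show ?thesis using assms by (elim conjE bspec)
qed

lemma fourier_eq:
  assumes "S \<subseteq> {1..n}"
  shows "fourier n f S = (\<Sum>x\<in>Omega n. f x * walsh n S x) / 2 ^ n"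
  by (rule walsh_coeff_unique[of n f "fourier n f", OF fourier_expansion assms])

end

theory Submission
  imports Defs
begin

text \<open>
  The noise operator multiplies the coefficient at \<open>S\<close> by \<open>(1 - 2\<epsilon>) ^ card S\<close>. So by Parseval
  the variance of \<open>P(N\<^sub>\<epsilon>(x) \<in> A | x)\<close> is the sum of \<open>(1 - 2\<epsilon>) ^ (2 * card S) * g(S)\<^sup>2\<close> over
  nonempty \<open>S\<close>, and the flip probability is twice the sum of \<open>(1 - (1 - 2\<epsilon>) ^ card S) * g(S)\<^sup>2\<close>.
  Since \<open>\<phi>\<close> is small exactly if the variance is (Chebyshev), and \<open>\<Sum>g\<^sup>2 \<le> 1\<close>, both criteria
  follow by splitting these sums at \<open>card S = k\<close>.
\<close>

section \<open>Limits, Parseval's identity and the Fourier weights of indicators\<close>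

lemma finite_walsh_index [simp]:
  "finite {S. S \<subseteq> {1..n::nat}}" "finite {S. S \<subseteq> {1..n} \<and> P S}"
  by (auto intro: finite_subset[of _ "Pow {1..n}"])

lemma tendsto_0_nonnegI:
  fixes f :: "'a \<Rightarrow> real"
  assumes "\<And>x. 0 \<le> f x" "\<And>e. 0 < e \<Longrightarrow> \<forall>\<^sub>F x in F. f x < e"
  shows "(f \<longlongrightarrow> 0) F"
proof (rule order_tendstoI)
  fix a :: real assume "a < 0"
  then show "\<forall>\<^sub>F x in F. a < f x"
    using less_le_trans[OF _ assms(1)] by (intro always_eventually allI)
qed (rule assms(2))

lemma prob_unif: "measure_pmf.prob (unif n) B = (\<Sum>x\<in>Omega n. indicat_real B x) / 2 ^ n"
  by (simp add: unif_def measure_pmf_of_set card_Omega indicator_def sum.If_cases)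

text \<open>Polarised Parseval: after expanding the product, orthogonality leaves only the diagonal
  terms. Two coefficient families are allowed because the flip probability pairs the indicator with
  its noisy average.\<close>

lemma parseval_walsh:
  "(\<Sum>x\<in>Omega n. (\<Sum>S | S \<subseteq> {1..n}. c S * walsh n S x) * (\<Sum>S | S \<subseteq> {1..n}. d S * walsh n S x))
     = 2 ^ n * (\<Sum>S | S \<subseteq> {1..n}. c S * d S)"
proof -
  have "(\<Sum>x\<in>Omega n. (\<Sum>S | S \<subseteq> {1..n}. c S * walsh n S x) * (\<Sum>S | S \<subseteq> {1..n}. d S * walsh n S x))
      = (\<Sum>x\<in>Omega n. \<Sum>S | S \<subseteq> {1..n}. \<Sum>T | T \<subseteq> {1..n}. c S * d T * (walsh n S x * walsh n T x))"
    unfolding sum_product by (intro sum.cong refl) simp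
  also have "\<dots> = (\<Sum>S | S \<subseteq> {1..n}. \<Sum>x\<in>Omega n. \<Sum>T | T \<subseteq> {1..n}. c S * d T * (walsh n S x * walsh n T x))"
    by (rule sum.swap)
  also have "\<dots> = (\<Sum>S | S \<subseteq> {1..n}. \<Sum>T | T \<subseteq> {1..n}. \<Sum>x\<in>Omega n. c S * d T * (walsh n S x * walsh n T x))"
    by (intro sum.cong refl sum.swap)
  also have "\<dots> = (\<Sum>S | S \<subseteq> {1..n}. \<Sum>T | T \<subseteq> {1..n}. if S = T then c S * d T * 2 ^ n else 0)"
    unfolding sum_distrib_left[symmetric]
    by (intro sum.cong refl) (simp add: walsh_orthogonal del: One_nat_def)
  also have "\<dots> = (\<Sum>S | S \<subseteq> {1..n}. c S * d S * 2 ^ n)"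
    by (intro sum.cong refl) (simp del: One_nat_def)
  finally show ?thesis by (simp add: sum_distrib_left mult_ac)
qed

lemma fourier_empty: "fourier n (indicat_real A) {} = measure_pmf.prob (unif n) A"
  by (simp add: fourier_eq prob_unif walsh_def)

text \<open>An indicator is its own square, so its squared norm is its mean.\<close>

lemma sum_fourier_squared:
  "(\<Sum>S | S \<subseteq> {1..n}. (fourier n (indicat_real A) S)\<^sup>2) = measure_pmf.prob (unif n) A"
proof -
  have "2 ^ n * (\<Sum>S | S \<subseteq> {1..n}. fourier n (indicat_real A) S * fourier n (indicat_real A) S)
      = (\<Sum>x\<in>Omega n. indicat_real A x * indicat_real A x)"
    unfolding parseval_walsh[symmetric]
    by (intro sum.cong refl) (simp only: fourier_expansion[of _ n "indicat_real A"])
  also have "\<dots> = (\<Sum>x\<in>Omega n. indicat_real A x)"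
    by (intro sum.cong refl) (simp add: indicator_def)
  finally show ?thesis by (simp add: prob_unif power2_eq_square field_simps)
qed

text \<open>Applied with \<open>P\<close> selecting a range of sizes: bounds the weight of any block
  of levels uniformly in \<open>n\<close> and \<open>A\<close>.\<close>

lemma sum_fourier_squared_le_1:
  "(\<Sum>S | S \<subseteq> {1..n} \<and> P S. (fourier n (indicat_real A) S)\<^sup>2) \<le> 1"
proof -
  have "(\<Sum>S | S \<subseteq> {1..n} \<and> P S. (fourier n (indicat_real A) S)\<^sup>2)
      \<le> (\<Sum>S | S \<subseteq> {1..n}. (fourier n (indicat_real A) S)\<^sup>2)"
    by (rule sum_mono2) auto
  also have "\<dots> \<le> 1" unfolding sum_fourier_squared by simp
  finally show ?thesis .
qed

section \<open>The noise operator on Walsh functions and on events\<close>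

lemma integrable_noise [simp]: "integrable (measure_pmf (noise n \<epsilon> x)) (f :: _ \<Rightarrow> real)"
  by (rule integrable_measure_pmf_finite, rule finite_subset[OF noise_in_Omega finite_Omega])

text \<open>Both the Walsh function and the noise law factor over coordinates. A coordinate in
  \<open>S\<close> keeps its sign with probability 1 - \<epsilon> and reverses it with probability
  \<epsilon>, which gives the factor 1 - 2\<epsilon>; any other coordinate contributes 1.\<close>

lemma expectation_noise_walsh:
  assumes S: "S \<subseteq> {1..n}" and \<epsilon>: "0 \<le> \<epsilon>" "\<epsilon> \<le> 1"
  shows "measure_pmf.expectation (noise n \<epsilon> x) (walsh n S) = (1 - 2 * \<epsilon>) ^ card S * walsh n S x"
proof -
  define p where "p j = map_pmf (\<lambda>b. if b then \<not> x j else x j) (bernoulli_pmf \<epsilon>)" for j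
  define h :: "nat \<Rightarrow> bool \<Rightarrow> real" where "h j b = (if j \<in> S \<and> b then -1 else 1)" for j b
  have "measure_pmf.expectation (noise n \<epsilon> x) (walsh n S) =
      (\<Sum>y\<in>Omega n. walsh n S y * pmf (noise n \<epsilon> x) y)"
    by (rule integral_measure_pmf_real[OF finite_Omega subsetD[OF noise_in_Omega]])
  also have "\<dots> = (\<Sum>y\<in>Omega n. \<Prod>j\<in>{1..n}. h j (y j) * pmf (p j) (y j))"
  proof (rule sum.cong[OF refl])
    fix y assume "y \<in> Omega n"
    \<comment> \<open>On \<open>Omega n\<close> the function \<open>y\<close> takes the default
      value \<open>undefined\<close> off \<open>{1..n}\<close>, as the product formula for
      \<open>Pi_pmf\<close> requires.\<close>
    then have "pmf (noise n \<epsilon> x) y = (\<Prod>j\<in>{1..n}. pmf (p j) (y j))"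
      unfolding noise_def p_def by (intro pmf_Pi') (auto simp: Omega_def)
    then show "walsh n S y * pmf (noise n \<epsilon> x) y = (\<Prod>j\<in>{1..n}. h j (y j) * pmf (p j) (y j))"
      unfolding walsh_eq_prod_full[OF S] h_def prod.distrib by (simp only:)
  qed
  also have "\<dots> = (\<Prod>j\<in>{1..n}. \<Sum>b\<in>UNIV. h j b * pmf (p j) b)"
    unfolding Omega_def by (rule prod_sum_PiE[symmetric]) auto
  also have "\<dots> = (\<Prod>j\<in>{1..n}. measure_pmf.expectation (p j) (h j))"
    by (intro prod.cong refl integral_measure_pmf_real[symmetric]) auto
  also have "\<dots> = (\<Prod>j\<in>{1..n}. if j \<in> S then (1 - 2 * \<epsilon>) * (if x j then -1 else 1) else 1)"
    by (intro prod.cong refl) (use \<epsilon> in \<open>auto simp: p_def h_def algebra_simps\<close>)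
  also have "\<dots> = (\<Prod>j\<in>S. (1 - 2 * \<epsilon>) * (if x j then -1 else 1))"
    by (rule prod.mono_neutral_cong_right) (use S in auto)
  also have "\<dots> = (1 - 2 * \<epsilon>) ^ card S * walsh n S x"
    by (simp add: prod.distrib walsh_eq_prod[OF S])
  finally show ?thesis .
qed

lemma prob_noise:
  assumes \<epsilon>: "0 \<le> \<epsilon>" "\<epsilon> \<le> 1"
  shows "measure_pmf.prob (noise n \<epsilon> x) A =
    (\<Sum>S | S \<subseteq> {1..n}. (1 - 2 * \<epsilon>) ^ card S * fourier n (indicat_real A) S * walsh n S x)"
proof -
  have "measure_pmf.prob (noise n \<epsilon> x) A = measure_pmf.expectation (noise n \<epsilon> x) (indicat_real A)"
    by simp
  also have "\<dots> = measure_pmf.expectation (noise n \<epsilon> x)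
      (\<lambda>y. \<Sum>S | S \<subseteq> {1..n}. fourier n (indicat_real A) S * walsh n S y)"
    \<comment> \<open>The expansion is available on \<open>Omega n\<close>, which carries the noise
      law; hence a congruence almost everywhere.\<close>
    by (intro integral_cong_AE)
       (auto simp: AE_measure_pmf_iff simp del: One_nat_def
         intro!: fourier_expansion subsetD[OF noise_in_Omega])
  also have "\<dots> = (\<Sum>S | S \<subseteq> {1..n}. fourier n (indicat_real A) S *
      measure_pmf.expectation (noise n \<epsilon> x) (walsh n S))"
    by (subst Bochner_Integration.integral_sum) simp_all
  also have "\<dots> = (\<Sum>S | S \<subseteq> {1..n}. (1 - 2 * \<epsilon>) ^ card S * fourier n (indicat_real A) S * walsh n S x)"
    by (intro sum.cong refl) (simp add: expectation_noise_walsh \<epsilon> del: One_nat_def)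
  finally show ?thesis .
qed

section \<open>Variance of the noisy conditional probability and its relation to
  \<open>sens_phi\<close>\<close>

text \<open>A variance: the noise preserves the uniform law, so the subtracted constant is the mean
  of the conditional probability.\<close>

definition noise_var :: "nat \<Rightarrow> (nat \<Rightarrow> bool) set \<Rightarrow> real \<Rightarrow> real" where
  "noise_var n A \<epsilon> = (\<Sum>x\<in>Omega n.
     (measure_pmf.prob (noise n \<epsilon> x) A - measure_pmf.prob (unif n) A)\<^sup>2) / 2 ^ n"

lemma noise_var_nonneg: "0 \<le> noise_var n A \<epsilon>"
  by (simp add: noise_var_def sum_nonneg)

lemma noise_var_eq:
  assumes \<epsilon>: "0 \<le> \<epsilon>" "\<epsilon> \<le> 1"
  shows "noise_var n A \<epsilon> = (\<Sum>S | S \<subseteq> {1..n} \<and> 1 \<le> card S.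
    (1 - 2 * \<epsilon>) ^ (2 * card S) * (fourier n (indicat_real A) S)\<^sup>2)"
proof -
  let ?g = "fourier n (indicat_real A)"
  \<comment> \<open>Coefficients of the centred function: the coefficient at the empty set is P(A),
    so subtracting P(A) deletes exactly that term.\<close>
  define c where "c S = (if S = {} then 0 else (1 - 2 * \<epsilon>) ^ card S * ?g S)" for S
  have D: "measure_pmf.prob (noise n \<epsilon> x) A - measure_pmf.prob (unif n) A
      = (\<Sum>S | S \<subseteq> {1..n}. c S * walsh n S x)" for x
  proof -
    have "(\<Sum>S | S \<subseteq> {1..n}. (1 - 2 * \<epsilon>) ^ card S * ?g S * walsh n S x)
        = (\<Sum>S | S \<subseteq> {1..n}. c S * walsh n S x + (if S = {} then ?g {} else 0))"
      by (intro sum.cong refl) (simp add: c_def walsh_def)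
    also have "\<dots> = (\<Sum>S | S \<subseteq> {1..n}. c S * walsh n S x) + ?g {}"
      by (simp add: sum.distrib)
    finally show ?thesis by (simp add: prob_noise[OF \<epsilon>] fourier_empty)
  qed
  have "noise_var n A \<epsilon> = (\<Sum>S | S \<subseteq> {1..n}. c S * c S)"
    unfolding noise_var_def D power2_eq_square parseval_walsh by simp
  also have "\<dots> = (\<Sum>S | S \<subseteq> {1..n} \<and> 1 \<le> card S. (1 - 2 * \<epsilon>) ^ (2 * card S) * (?g S)\<^sup>2)"
  proof (rule sum.mono_neutral_cong_right)
    show "\<forall>S\<in>{S. S \<subseteq> {1..n}} - {S. S \<subseteq> {1..n} \<and> 1 \<le> card S}. c S * c S = 0"
    proof
      fix S assume S: "S \<in> {S. S \<subseteq> {1..n}} - {S. S \<subseteq> {1..n} \<and> 1 \<le> card S}"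
      \<comment> \<open>Infinite sets also have \<open>card\<close> 0, so emptiness is concluded
        from finiteness.\<close>
      then have "finite S" using finite_subset by blast
      with S have "S = {}" by (simp add: not_le)
      then show "c S * c S = 0" by (simp add: c_def)
    qed
  next
    fix S assume "S \<in> {S. S \<subseteq> {1..n} \<and> 1 \<le> card S}"
    then have "S \<noteq> {}" by auto
    then show "c S * c S = (1 - 2 * \<epsilon>) ^ (2 * card S) * (?g S)\<^sup>2"
      by (simp add: c_def power_even_eq power2_eq_square)
  qed auto
  finally show ?thesis .
qed

text \<open>Makes the real infimum in \<open>sens_phi\<close> well behaved: the set is nonempty and
  bounded below. The threshold 2 is admissible because it exceeds every probability.\<close>

lemma sens_phi_set:
  "2 \<in> {\<delta>. \<delta> > 0 \<and> sens_gamma n A \<epsilon> \<delta> < \<delta>}" "bdd_below {\<delta>. \<delta> > 0 \<and> sens_gamma n A \<epsilon> \<delta> < \<delta>}"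
proof -
  have "sens_gamma n A \<epsilon> 2 \<le> 1" by (simp add: sens_gamma_def)
  then show "2 \<in> {\<delta>. \<delta> > 0 \<and> sens_gamma n A \<epsilon> \<delta> < \<delta>}" by simp
  show "bdd_below {\<delta>. \<delta> > 0 \<and> sens_gamma n A \<epsilon> \<delta> < \<delta>}"
    by (rule bdd_belowI[of _ 0]) auto
qed

lemma sens_phi_nonneg: "0 \<le> sens_phi n A \<epsilon>"
  unfolding sens_phi_def
proof (rule cInf_greatest)
  show "{\<delta>. \<delta> > 0 \<and> sens_gamma n A \<epsilon> \<delta> < \<delta>} \<noteq> {}" using sens_phi_set(1) by blast
qed auto

text \<open>Chebyshev's inequality, proved pointwise: where the deviation exceeds \<delta>, its
  square is at least \<delta> squared.\<close>

lemma sens_gamma_le: "\<delta> > 0 \<Longrightarrow> \<delta>\<^sup>2 * sens_gamma n A \<epsilon> \<delta> \<le> noise_var n A \<epsilon>"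
  unfolding sens_gamma_def prob_unif noise_var_def times_divide_eq_right sum_distrib_left
  by (intro divide_right_mono sum_mono)
     (auto simp: indicator_def abs_le_square_iff[symmetric])

text \<open>Converse to Chebyshev for bounded deviations: exceptional points contribute at most
  their probability, as deviations are at most 1, and the others at most \<delta> squared.\<close>

lemma noise_var_le:
  assumes "\<delta> > 0"
  shows "noise_var n A \<epsilon> \<le> \<delta>\<^sup>2 + sens_gamma n A \<epsilon> \<delta>"
proof -
  let ?D = "\<lambda>x. measure_pmf.prob (noise n \<epsilon> x) A - measure_pmf.prob (unif n) A"
  let ?B = "{x \<in> Omega n. \<bar>?D x\<bar> > \<delta>}"
  have "(?D x)\<^sup>2 \<le> \<delta>\<^sup>2 + indicat_real ?B x" if "x \<in> Omega n" for x
  proof (cases "\<bar>?D x\<bar> > \<delta>")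
    case True
    have "\<bar>?D x\<bar> \<le> 1"
      using measure_pmf.prob_le_1[of "noise n \<epsilon> x" A] measure_pmf.prob_le_1[of "unif n" A]
        measure_nonneg[of "noise n \<epsilon> x" A] measure_nonneg[of "unif n" A] by linarith
    then have "(?D x)\<^sup>2 \<le> 1" by (simp add: abs_square_le_1)
    then show ?thesis using True that by (simp add: add_increasing)
  next
    case False
    then have "(?D x)\<^sup>2 \<le> \<delta>\<^sup>2" using assms by (simp add: abs_le_square_iff[symmetric])
    then show ?thesis by (simp add: add_increasing2)
  qed
  then have "noise_var n A \<epsilon> \<le> (\<Sum>x\<in>Omega n. \<delta>\<^sup>2 + indicat_real ?B x) / 2 ^ n"
    unfolding noise_var_def by (intro divide_right_mono sum_mono) auto
  also have "\<dots> = \<delta>\<^sup>2 + sens_gamma n A \<epsilon> \<delta>"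
    by (simp add: sens_gamma_def prob_unif sum.distrib card_Omega add_divide_distrib)
  finally show ?thesis .
qed

text \<open>The cube arises because Chebyshev loses \<delta> squared and admissibility asks for a
  probability below \<delta>.\<close>

lemma sens_phi_le:
  assumes "\<delta> > 0" "noise_var n A \<epsilon> < \<delta> ^ 3"
  shows "sens_phi n A \<epsilon> \<le> \<delta>"
proof -
  have "\<delta>\<^sup>2 * sens_gamma n A \<epsilon> \<delta> < \<delta>\<^sup>2 * \<delta>"
    using sens_gamma_le[OF assms(1), of n A \<epsilon>] assms(2) by (simp add: power2_eq_square power3_eq_cube)
  then have "sens_gamma n A \<epsilon> \<delta> < \<delta>" using assms(1) by simp
  then show ?thesis
    unfolding sens_phi_def using assms(1) by (intro cInf_lower sens_phi_set(2)) simp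
qed

text \<open>An infimum below \<delta> yields an admissible \<open>d\<close> below \<delta>; the
  bound for \<open>d\<close> then increases to the one for \<delta>.\<close>

lemma noise_var_le_of_sens_phi:
  assumes "sens_phi n A \<epsilon> < \<delta>"
  shows "noise_var n A \<epsilon> \<le> \<delta>\<^sup>2 + \<delta>"
proof -
  obtain d where d: "d > 0" "sens_gamma n A \<epsilon> d < d" "d < \<delta>"
    using cInf_lessD[OF _ assms[unfolded sens_phi_def]] sens_phi_set(1) by blast
  then have "d\<^sup>2 \<le> \<delta>\<^sup>2" by (intro power_mono) auto
  then show ?thesis using noise_var_le[OF d(1), of n A \<epsilon>] d by linarith
qed

text \<open>Exchanges \<open>sens_phi\<close> for a quantity with an explicit Fourier formula: each
  controls the other by a bound vanishing at 0.\<close>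

lemma sens_phi_tendsto_iff:
  "(\<lambda>m. sens_phi (n m) (A m) \<epsilon>) \<longlonglongrightarrow> 0 \<longleftrightarrow> (\<lambda>m. noise_var (n m) (A m) \<epsilon>) \<longlonglongrightarrow> 0"
proof
  assume *: "(\<lambda>m. sens_phi (n m) (A m) \<epsilon>) \<longlonglongrightarrow> 0"
  show "(\<lambda>m. noise_var (n m) (A m) \<epsilon>) \<longlonglongrightarrow> 0"
  proof (rule tendsto_0_nonnegI)
    fix e :: real assume "0 < e"
    \<comment> \<open>The cap 1 gives \<open>d\<^sup>2 \<le> d\<close>, so the bound
      \<open>d\<^sup>2 + d\<close> is at most 2e/3.\<close>
    define d where "d = min 1 (e / 3)"
    have d: "0 < d" "d\<^sup>2 + d < e"
    proof -
      show "0 < d" using \<open>0 < e\<close> by (simp add: d_def)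
      then have "d * d \<le> d * 1" by (intro mult_left_mono) (auto simp: d_def)
      moreover have "d \<le> e / 3" by (simp add: d_def)
      ultimately show "d\<^sup>2 + d < e" using \<open>0 < e\<close> by (simp add: power2_eq_square)
    qed
    show "\<forall>\<^sub>F m in sequentially. noise_var (n m) (A m) \<epsilon> < e"
      using order_tendstoD(2)[OF * d(1)]
      by eventually_elim (rule le_less_trans[OF noise_var_le_of_sens_phi d(2)])
  qed (rule noise_var_nonneg)
next
  assume *: "(\<lambda>m. noise_var (n m) (A m) \<epsilon>) \<longlonglongrightarrow> 0"
  show "(\<lambda>m. sens_phi (n m) (A m) \<epsilon>) \<longlonglongrightarrow> 0"
  proof (rule tendsto_0_nonnegI)
    fix e :: real assume "0 < e"
    then have e: "0 < e / 2" "e / 2 < e" by simp_all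
    from order_tendstoD(2)[OF * zero_less_power[OF e(1), of 3]]
    show "\<forall>\<^sub>F m in sequentially. sens_phi (n m) (A m) \<epsilon> < e"
      by eventually_elim (rule le_less_trans[OF sens_phi_le[OF e(1)] e(2)])
  qed (rule sens_phi_nonneg)
qed

section \<open>Comparing the variance with the weight on low levels\<close>

text \<open>The base 1 - 2\<epsilon> lies in [0,1], so up to level \<open>k\<close> the damping
  factor is at least its value at \<open>k\<close>; the dropped terms are nonnegative.\<close>

lemma low_level_le_noise_var:
  assumes \<epsilon>: "0 \<le> \<epsilon>" "\<epsilon> \<le> 1/2"
  shows "(1 - 2 * \<epsilon>) ^ (2 * k) * (\<Sum>S | S \<subseteq> {1..n} \<and> 1 \<le> card S \<and> card S \<le> k.
    (fourier n (indicat_real A) S)\<^sup>2) \<le> noise_var n A \<epsilon>"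
proof -
  have "\<epsilon> \<le> 1" using \<epsilon> by simp
  have "(1 - 2 * \<epsilon>) ^ (2 * k) * (\<Sum>S | S \<subseteq> {1..n} \<and> 1 \<le> card S \<and> card S \<le> k.
      (fourier n (indicat_real A) S)\<^sup>2) \<le> (\<Sum>S | S \<subseteq> {1..n} \<and> 1 \<le> card S \<and> card S \<le> k.
      (1 - 2 * \<epsilon>) ^ (2 * card S) * (fourier n (indicat_real A) S)\<^sup>2)"
    unfolding sum_distrib_left using \<epsilon>
    by (intro sum_mono mult_right_mono power_decreasing) auto
  also have "\<dots> \<le> noise_var n A \<epsilon>"
    unfolding noise_var_eq[OF \<epsilon>(1) \<open>\<epsilon> \<le> 1\<close>] using \<epsilon>
    by (intro sum_mono2) auto
  finally show ?thesis .
qed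

text \<open>Damping is at most 1 on low levels. Above level \<open>k\<close> it is at most its value
  at \<open>k\<close>, and the total weight there is at most 1.\<close>

lemma noise_var_le_low_level:
  assumes \<epsilon>: "0 \<le> \<epsilon>" "\<epsilon> \<le> 1/2"
  shows "noise_var n A \<epsilon> \<le> (\<Sum>S | S \<subseteq> {1..n} \<and> 1 \<le> card S \<and> card S \<le> k.
    (fourier n (indicat_real A) S)\<^sup>2) + (1 - 2 * \<epsilon>) ^ (2 * k)"
proof -
  let ?g = "fourier n (indicat_real A)"
  let ?r = "1 - 2 * \<epsilon>"
  have r: "0 \<le> ?r" "?r \<le> 1" using \<epsilon> by auto
  let ?L = "{S. S \<subseteq> {1..n} \<and> 1 \<le> card S \<and> card S \<le> k}"
  let ?H = "{S. S \<subseteq> {1..n} \<and> 1 \<le> card S \<and> k < card S}"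
  have "noise_var n A \<epsilon> = (\<Sum>S\<in>?L \<union> ?H. ?r ^ (2 * card S) * (?g S)\<^sup>2)"
    using \<epsilon> by (subst noise_var_eq) (auto intro!: sum.cong)
  also have "\<dots> = (\<Sum>S\<in>?L. ?r ^ (2 * card S) * (?g S)\<^sup>2) + (\<Sum>S\<in>?H. ?r ^ (2 * card S) * (?g S)\<^sup>2)"
    by (rule sum.union_disjoint) (simp_all del: One_nat_def, auto)
  also have "\<dots> \<le> (\<Sum>S\<in>?L. (?g S)\<^sup>2) + (\<Sum>S\<in>?H. ?r ^ (2 * k) * (?g S)\<^sup>2)"
    using r by (intro add_mono sum_mono mult_right_mono power_decreasing mult_left_le_one_le)
      (auto simp: power_le_one)
  also have "(\<Sum>S\<in>?H. ?r ^ (2 * k) * (?g S)\<^sup>2) \<le> ?r ^ (2 * k)"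
    unfolding sum_distrib_left[symmetric]
    using r sum_fourier_squared_le_1[where P = "\<lambda>S. 1 \<le> card S \<and> k < card S"]
    by (intro mult_left_le) auto
  finally show ?thesis by simp
qed

section \<open>The flip probability and the weight on high levels\<close>

text \<open>With f the indicator and Q the noisy conditional probability, disagreement given x has
  probability f + Q - 2fQ. Both f and Q have mean P(A), so the flip probability is 2(P(A) - E[fQ]);
  Parseval expands both terms.\<close>

lemma flip_prob_eq:
  assumes \<epsilon>: "0 \<le> \<epsilon>" "\<epsilon> \<le> 1"
  shows "flip_prob n A \<epsilon> =
    2 * (\<Sum>S | S \<subseteq> {1..n}. (1 - (1 - 2 * \<epsilon>) ^ card S) * (fourier n (indicat_real A) S)\<^sup>2)"
proof -
  let ?g = "fourier n (indicat_real A)"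
  let ?f = "indicat_real A"
  let ?Q = "\<lambda>x. measure_pmf.prob (noise n \<epsilon> x) A"
  let ?p = "measure_pmf.prob (unif n) A"
  have cond: "measure_pmf.prob (noise n \<epsilon> x) {y. (x \<in> A) \<noteq> (y \<in> A)} = ?f x + ?Q x - 2 * (?f x * ?Q x)" for x
  proof (cases "x \<in> A")
    case True
    then have "{y. (x \<in> A) \<noteq> (y \<in> A)} = UNIV - A" by auto
    then show ?thesis using True measure_pmf.prob_compl[of A "noise n \<epsilon> x"] by simp
  qed simp
  have "flip_prob n A \<epsilon> = measure_pmf.expectation (unif n)
      (\<lambda>x. measure_pmf.prob (noise n \<epsilon> x) {y. (x \<in> A) \<noteq> (y \<in> A)})"
    unfolding flip_prob_def noisy_pair_def measure_pmf_bind
    by (subst measure_pmf.measure_bind[where N = "count_space UNIV"])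
       (auto simp: vimage_def space_subprob_algebra intro!: Bochner_Integration.integral_cong
         measure_pmf.subprob_space_axioms)
  also have "\<dots> = (\<Sum>x\<in>Omega n. ?f x + ?Q x - 2 * (?f x * ?Q x)) / 2 ^ n"
    unfolding cond by (simp add: unif_def integral_pmf_of_set card_Omega)
  also have "\<dots> = ?p + (\<Sum>x\<in>Omega n. ?Q x) / 2 ^ n - 2 * ((\<Sum>x\<in>Omega n. ?f x * ?Q x) / 2 ^ n)"
    unfolding prob_unif sum_subtractf sum.distrib sum_distrib_left[symmetric] diff_divide_distrib
      add_divide_distrib times_divide_eq_right ..
  also have "(\<Sum>x\<in>Omega n. ?f x * ?Q x) =
      2 ^ n * (\<Sum>S | S \<subseteq> {1..n}. ?g S * ((1 - 2 * \<epsilon>) ^ card S * ?g S))"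
    unfolding parseval_walsh[symmetric] prob_noise[OF \<epsilon>]
    by (intro sum.cong refl) (simp only: fourier_expansion[of _ n "indicat_real A"])
  \<comment> \<open>The mean of Q is its pairing with the constant 1, the Walsh function of the
    empty set, so it is the coefficient there.\<close>
  also have "(\<Sum>x\<in>Omega n. ?Q x) = 2 ^ n * ?p"
  proof -
    have "(\<Sum>S | S \<subseteq> {1..n}. (if S = {} then 1 else 0) * walsh n S x) = 1" for x
      by (simp add: if_distrib[of "\<lambda>t. t * _"] walsh_def cong: if_cong)
    then have "(\<Sum>x\<in>Omega n. ?Q x) = (\<Sum>x\<in>Omega n.
        (\<Sum>S | S \<subseteq> {1..n}. (if S = {} then 1 else 0) * walsh n S x) * ?Q x)" by simp
    also have "\<dots> = 2 ^ n * ?g {}"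
      unfolding prob_noise[OF \<epsilon>] parseval_walsh
      by (simp add: if_distrib[of "\<lambda>t. t * _"] cong: if_cong)
    finally show ?thesis by (simp add: fourier_empty)
  qed
  finally have "flip_prob n A \<epsilon> = 2 * (?p - (\<Sum>S | S \<subseteq> {1..n}. (1 - 2 * \<epsilon>) ^ card S * (?g S)\<^sup>2))"
    by (simp add: power2_eq_square mult_ac)
  then show ?thesis
    unfolding sum_fourier_squared[symmetric] by (simp add: sum_subtractf left_diff_distrib)
qed

text \<open>The factor 1 - (1 - 2\<epsilon>)^j grows with the level j, and the levels below
  \<open>k\<close> contribute nonnegative terms.\<close>

lemma high_level_le_flip_prob:
  assumes \<epsilon>: "0 \<le> \<epsilon>" "\<epsilon> \<le> 1/2"
  shows "2 * (1 - (1 - 2 * \<epsilon>) ^ k) * (\<Sum>S | S \<subseteq> {1..n} \<and> card S \<ge> k.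
    (fourier n (indicat_real A) S)\<^sup>2) \<le> flip_prob n A \<epsilon>"
proof -
  have "\<epsilon> \<le> 1" using \<epsilon> by simp
  have "(1 - (1 - 2 * \<epsilon>) ^ k) * (\<Sum>S | S \<subseteq> {1..n} \<and> card S \<ge> k. (fourier n (indicat_real A) S)\<^sup>2)
      \<le> (\<Sum>S | S \<subseteq> {1..n} \<and> card S \<ge> k.
          (1 - (1 - 2 * \<epsilon>) ^ card S) * (fourier n (indicat_real A) S)\<^sup>2)"
    unfolding sum_distrib_left using \<epsilon>
    by (intro sum_mono mult_right_mono diff_left_mono power_decreasing) auto
  also have "\<dots> \<le> (\<Sum>S | S \<subseteq> {1..n}. (1 - (1 - 2 * \<epsilon>) ^ card S) * (fourier n (indicat_real A) S)\<^sup>2)"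
    using \<epsilon> by (intro sum_mono2) (auto simp: power_le_one)
  finally show ?thesis
    unfolding flip_prob_eq[OF \<epsilon>(1) \<open>\<epsilon> \<le> 1\<close>] mult.assoc by (rule mult_left_mono) simp
qed

text \<open>From level \<open>k\<close> on the factor is at most 1. Below \<open>k\<close> it is at
  most its value at \<open>k\<close>, and the total weight there is at most 1.\<close>

lemma flip_prob_le_high_level:
  assumes \<epsilon>: "0 \<le> \<epsilon>" "\<epsilon> \<le> 1/2"
  shows "flip_prob n A \<epsilon> \<le> 2 * (\<Sum>S | S \<subseteq> {1..n} \<and> card S \<ge> k.
    (fourier n (indicat_real A) S)\<^sup>2) + 2 * (1 - (1 - 2 * \<epsilon>) ^ k)"
proof -
  let ?g = "fourier n (indicat_real A)"
  let ?r = "1 - 2 * \<epsilon>"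
  have r: "0 \<le> ?r" "?r \<le> 1" using \<epsilon> by auto
  let ?L = "{S. S \<subseteq> {1..n} \<and> card S < k}"
  let ?H = "{S. S \<subseteq> {1..n} \<and> card S \<ge> k}"
  have "(\<Sum>S | S \<subseteq> {1..n}. (1 - ?r ^ card S) * (?g S)\<^sup>2) = (\<Sum>S\<in>?H \<union> ?L. (1 - ?r ^ card S) * (?g S)\<^sup>2)"
    by (intro sum.cong) auto
  also have "\<dots> = (\<Sum>S\<in>?H. (1 - ?r ^ card S) * (?g S)\<^sup>2) + (\<Sum>S\<in>?L. (1 - ?r ^ card S) * (?g S)\<^sup>2)"
    by (rule sum.union_disjoint) (simp_all del: One_nat_def, auto)
  also have "\<dots> \<le> (\<Sum>S\<in>?H. (?g S)\<^sup>2) + (\<Sum>S\<in>?L. (1 - ?r ^ k) * (?g S)\<^sup>2)"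
    using r by (intro add_mono sum_mono mult_right_mono diff_left_mono power_decreasing
      mult_left_le_one_le) (auto simp: power_le_one)
  also have "(\<Sum>S\<in>?L. (1 - ?r ^ k) * (?g S)\<^sup>2) \<le> 1 - ?r ^ k"
    unfolding sum_distrib_left[symmetric]
    using r sum_fourier_squared_le_1[where P = "\<lambda>S. card S < k"]
    by (intro mult_left_le) (auto simp: power_le_one)
  finally show ?thesis using \<epsilon> by (simp add: flip_prob_eq)
qed

section \<open>The two spectral criteria\<close>

lemma asymp_noise_sensitive_iff_low_levels:
  "asymp_noise_sensitive n A \<longleftrightarrow>
     (\<forall>k::nat. (\<lambda>m. \<Sum>S | S \<subseteq> {1..n m} \<and> 1 \<le> card S \<and> card S \<le> k.
        (fourier (n m) (indicat_real (A m)) S)\<^sup>2) \<longlonglongrightarrow> 0)"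
  (is "_ \<longleftrightarrow> (\<forall>k. ?W k \<longlonglongrightarrow> 0)")
proof
  assume "asymp_noise_sensitive n A"
  \<comment> \<open>One noise level suffices in this direction; at 1/4 the base is 1/2, so the loss
    at level \<open>k\<close> is the constant \<open>2 ^ (2 * k)\<close>.\<close>
  then have "(\<lambda>m. sens_phi (n m) (A m) (1/4)) \<longlonglongrightarrow> 0"
    by (simp add: asymp_noise_sensitive_def)
  then have V: "(\<lambda>m. noise_var (n m) (A m) (1/4)) \<longlonglongrightarrow> 0"
    by (simp only: sens_phi_tendsto_iff)
  show "\<forall>k. ?W k \<longlonglongrightarrow> 0"
  proof
    fix k
    have lim: "(\<lambda>m. 2 ^ (2 * k) * noise_var (n m) (A m) (1/4)) \<longlonglongrightarrow> 0"
      using tendsto_mult_right_zero[OF V] by simp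
    have le: "?W k m \<le> 2 ^ (2 * k) * noise_var (n m) (A m) (1/4)" for m
      using low_level_le_noise_var[of "1/4" k "n m" "A m"] by (simp add: field_simps)
    show "?W k \<longlonglongrightarrow> 0"
      by (rule tendsto_sandwich[OF _ always_eventually tendsto_const lim])
         (use le in \<open>auto simp: sum_nonneg simp del: One_nat_def\<close>)
  qed
next
  assume W: "\<forall>k. ?W k \<longlonglongrightarrow> 0"
  show "asymp_noise_sensitive n A"
    unfolding asymp_noise_sensitive_def sens_phi_tendsto_iff
  proof (intro allI impI)
    fix \<epsilon> :: real assume \<epsilon>: "0 < \<epsilon> \<and> \<epsilon> < 1/2"
    show "(\<lambda>m. noise_var (n m) (A m) \<epsilon>) \<longlonglongrightarrow> 0"
    proof (rule tendsto_0_nonnegI)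
      fix e :: real assume "0 < e"
      \<comment> \<open>The cutoff \<open>k\<close> depends on \<epsilon> and \<open>e\<close>
        alone, so the high levels are small uniformly in \<open>m\<close> before \<open>m\<close>
        tends to infinity.\<close>
      have "(1 - 2 * \<epsilon>)\<^sup>2 < 1" using \<epsilon> by (simp add: power_less_one_iff)
      then obtain k where "((1 - 2 * \<epsilon>)\<^sup>2) ^ k < e / 2"
        using real_arch_pow_inv[of "e / 2" "(1 - 2 * \<epsilon>)\<^sup>2"] \<open>0 < e\<close> by auto
      then have k: "(1 - 2 * \<epsilon>) ^ (2 * k) < e / 2" by (simp only: power_mult)
      have "\<forall>\<^sub>F m in sequentially. ?W k m < e / 2"
        using W \<open>0 < e\<close> by (intro order_tendstoD(2)[of _ 0]) auto
      then show "\<forall>\<^sub>F m in sequentially. noise_var (n m) (A m) \<epsilon> < e"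
      proof eventually_elim
        case (elim m)
        then show ?case
          using noise_var_le_low_level[of \<epsilon> "n m" "A m" k] \<epsilon> k by linarith
      qed
    qed (rule noise_var_nonneg)
  qed
qed

lemma uniformly_stable_iff_high_levels:
  assumes "I \<noteq> {}"
  shows "uniformly_stable I n A \<longleftrightarrow>
    (\<lambda>k::nat. SUP i\<in>I. \<Sum>S | S \<subseteq> {1..n i} \<and> card S \<ge> k.
       (fourier (n i) (indicat_real (A i)) S)\<^sup>2) \<longlonglongrightarrow> 0"
  (is "_ \<longleftrightarrow> (\<lambda>k. SUP i\<in>I. ?T k i) \<longlonglongrightarrow> 0")
proof -
  \<comment> \<open>Together with \<open>I\<close> nonempty, this boundedness makes the real
    supremum meaningful.\<close>
  have bdd: "bdd_above (?T k ` I)" for k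
    by (rule bdd_aboveI2[of _ _ 1]) (rule sum_fourier_squared_le_1)
  have T_nonneg: "0 \<le> ?T k i" for k i by (simp add: sum_nonneg)
  have T_le: "?T k i \<le> (SUP i\<in>I. ?T k i)" if "i \<in> I" for k i
    by (rule cSUP_upper[OF that bdd])
  have Sup_nonneg: "0 \<le> (SUP i\<in>I. ?T k i)" for k
    using assms T_le T_nonneg order.trans by blast
  have flip_nonneg: "0 \<le> flip_prob (n i) (A i) \<epsilon>" for i \<epsilon>
    by (simp add: flip_prob_def)
  show ?thesis
  proof
    assume st: "uniformly_stable I n A"
    show "(\<lambda>k. SUP i\<in>I. ?T k i) \<longlonglongrightarrow> 0"
    proof (rule tendsto_0_nonnegI)
      fix e :: real assume "0 < e"
      \<comment> \<open>Uniformity yields one \<epsilon> serving every \<open>i\<close>. Half of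
        \<open>e\<close> leaves room because passing to the supremum gives only a weak
        inequality.\<close>
      then have "\<forall>\<^sub>F \<epsilon> in at_right 0. \<forall>i\<in>I. dist (flip_prob (n i) (A i) \<epsilon>) 0 < e / 2"
        using uniform_limitD[OF st[unfolded uniformly_stable_def], of "e / 2"] by simp
      moreover have "\<forall>\<^sub>F \<epsilon> in at_right (0::real). \<epsilon> \<in> {0<..<1/2}"
        by (rule eventually_at_right_real) simp
      ultimately have "\<forall>\<^sub>F \<epsilon> in at_right (0::real).
          0 < \<epsilon> \<and> \<epsilon> < 1/2 \<and> (\<forall>i\<in>I. flip_prob (n i) (A i) \<epsilon> < e / 2)"
        by eventually_elim (auto simp: flip_nonneg)
      then obtain \<epsilon> where \<epsilon>: "0 < \<epsilon>" "\<epsilon> < 1/2"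
        and flip: "\<And>i. i \<in> I \<Longrightarrow> flip_prob (n i) (A i) \<epsilon> < e / 2"
        using eventually_happens'[OF trivial_limit_at_right_real] by blast
      \<comment> \<open>From \<open>K\<close> on, the factor
        \<open>2 * (1 - (1 - 2 * \<epsilon>) ^ k)\<close> is at least 1, so the flip probability
        dominates the tail weight.\<close>
      obtain K where K: "(1 - 2 * \<epsilon>) ^ K < 1/2"
        using real_arch_pow_inv[of "1/2" "1 - 2 * \<epsilon>"] \<epsilon> by auto
      show "\<forall>\<^sub>F k in sequentially. (SUP i\<in>I. ?T k i) < e"
      proof (rule eventually_sequentiallyI)
        fix k assume "K \<le> k"
        then have "(1 - 2 * \<epsilon>) ^ k \<le> (1 - 2 * \<epsilon>) ^ K"
          using \<epsilon> by (intro power_decreasing) auto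
        with K have "1 \<le> 2 * (1 - (1 - 2 * \<epsilon>) ^ k)" by argo
        then have "?T k i \<le> 2 * (1 - (1 - 2 * \<epsilon>) ^ k) * ?T k i" for i
          using mult_right_mono[OF _ T_nonneg[of i k], of 1] by simp
        then have "?T k i \<le> e / 2" if "i \<in> I" for i
          using flip[OF that] high_level_le_flip_prob[of \<epsilon> k "n i" "A i"] \<epsilon>
          by (meson less_imp_le order.trans)
        then have "(SUP i\<in>I. ?T k i) \<le> e / 2" by (intro cSUP_least assms)
        then show "(SUP i\<in>I. ?T k i) < e" using \<open>0 < e\<close> by simp
      qed
    qed (rule Sup_nonneg)
  next
    assume lim: "(\<lambda>k. SUP i\<in>I. ?T k i) \<longlonglongrightarrow> 0"
    show "uniformly_stable I n A"
      unfolding uniformly_stable_def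
    proof (rule uniform_limitI)
      fix e :: real assume "0 < e"
      then have "\<forall>\<^sub>F k in sequentially. (SUP i\<in>I. ?T k i) < e / 4"
        using order_tendstoD(2)[OF lim, of "e / 4"] by simp
      \<comment> \<open>Fixing \<open>k\<close> first makes the doubled tail weight less than e/2
        for all \<open>i\<close>. The remaining error does not involve \<open>i\<close> and vanishes
        as \<epsilon> tends to 0.\<close>
      then obtain k where k: "(SUP i\<in>I. ?T k i) < e / 4"
        using eventually_happens'[OF sequentially_bot] by blast
      have "((\<lambda>\<epsilon>. 2 * (1 - (1 - 2 * \<epsilon>) ^ k)) \<longlongrightarrow> 2 * (1 - (1 - 2 * 0) ^ k)) (at_right (0::real))"
        by (intro tendsto_intros)
      then have "\<forall>\<^sub>F \<epsilon> in at_right (0::real). 2 * (1 - (1 - 2 * \<epsilon>) ^ k) < e / 2"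
        using \<open>0 < e\<close> by (intro order_tendstoD(2)) auto
      moreover have "\<forall>\<^sub>F \<epsilon> in at_right (0::real). \<epsilon> \<in> {0<..<1/2}"
        by (rule eventually_at_right_real) simp
      ultimately show "\<forall>\<^sub>F \<epsilon> in at_right 0. \<forall>i\<in>I. dist (flip_prob (n i) (A i) \<epsilon>) 0 < e"
      proof eventually_elim
        case (elim \<epsilon>)
        show ?case
        proof
          fix i assume "i \<in> I"
          have "flip_prob (n i) (A i) \<epsilon> \<le> 2 * ?T k i + 2 * (1 - (1 - 2 * \<epsilon>) ^ k)"
            using elim by (intro flip_prob_le_high_level) auto
          with T_le[OF \<open>i \<in> I\<close>, of k] k elim flip_nonneg[of i \<epsilon>]
          show "dist (flip_prob (n i) (A i) \<epsilon>) 0 < e" by simp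
        qed
      qed
    qed
  qed
qed

theorem theorem1p9:
  fixes n :: "nat \<Rightarrow> nat" and A :: "nat \<Rightarrow> (nat \<Rightarrow> bool) set"
  assumes events: "\<And>m. m \<ge> 1 \<Longrightarrow> A m \<subseteq> Omega (n m)"
  shows "(asymp_noise_sensitive n A \<longleftrightarrow>
           (\<forall>k::nat. (\<lambda>m. \<Sum>S | S \<subseteq> {1..n m} \<and> 1 \<le> card S \<and> card S \<le> k.
                        (fourier (n m) (indicat_real (A m)) S)\<^sup>2) \<longlonglongrightarrow> 0))
       \<and> (uniformly_stable {1..} n A \<longleftrightarrow>
           (\<lambda>k::nat. SUP m\<in>{1..}. \<Sum>S | S \<subseteq> {1..n m} \<and> card S \<ge> k.
                        (fourier (n m) (indicat_real (A m)) S)\<^sup>2) \<longlonglongrightarrow> 0)"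
  \<comment> \<open>The sequence starts at 1, so stability is taken over the nonempty index set
    \<open>{1..}\<close>.\<close>
  by (rule conjI[OF asymp_noise_sensitive_iff_low_levels uniformly_stable_iff_high_levels])
     (rule not_Ici_eq_empty)

end
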